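(* Let $\mathcal{A}$ be a unital C*-algebra (not necessarily commutative), let $n$ be a natural number, and let $A\in M_n(\mathcal{A})$ be a positive matrix. Let $M=AA^*$ and let $y\in\mathcal{A}^n$ be the vector of row sums of $A$, i.e. $y_j=\sum_{k=1}^n a_{j,k}$ where $A=[a_{j,k}]_{1\le j,k\le n}$. Then $$M\succeq \frac1n yy^*,$$ i.e. $$\langle Mx,x\rangle\ge\frac1n\langle yy^*x,x\rangle,\qquad \forall x\in\mathcal{A}^n.$$
   Context: $M_n(\mathcal{A})$ is the *-algebra of $n\times n$ matrices over $\mathcal{A}$ with the natural matrix operations and involution $[a_{j,k}]^*=[a_{k,j}^*]$. On $\mathcal{A}^n$ (column vectors, on which matrices act by left multiplication) use the $\mathcal{A}$-valued inner product $\langle (x_j)_{j=1}^n,(y_j)_{j=1}^n\rangle=\sum_{j=1}^n x_jy_j^*$. A matrix $A\in M_n(\mathcal{A})$ is called positive, written $A\succeq 0$, if $A=A^*$ and $\langle Ax,x\rangle\ge 0$ in $\mathcal{A}$ for all $x\in\mathcal{A}^n$. For matrices $A,B$, one writes $A\succeq B$ if all of $A$, $B$ and $A-B$ are positive. For a column vector $y\in\mathcal{A}^n$, $y^*$ is the row vector $(y_1^*,\dots,y_n^* )$ and $yy^*=[y_jy_k^*]_{1\le j,k\le n}$. *)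

theory Defs
  imports "HOL-Analysis.Analysis"
begin

text \<open>Unital C*-algebras. The classes of Banach spaces and normed algebras in the library are real,
  so complex scalar multiplication is added and required to extend the real one. As usual, a unit
  has norm 1 (in particular the zero algebra is not unital).\<close>

class cstar_algebra = real_normed_algebra_1 + banach +
  fixes scaleC :: "complex \<Rightarrow> 'a \<Rightarrow> 'a" (infixr "*\<^sub>C" 75)
    and star :: "'a \<Rightarrow> 'a"
  assumes scaleC_of_real: "complex_of_real r *\<^sub>C a = r *\<^sub>R a"
    and scaleC_add_right: "z *\<^sub>C (a + b) = z *\<^sub>C a + z *\<^sub>C b"
    and scaleC_add_left: "(z + w) *\<^sub>C a = z *\<^sub>C a + w *\<^sub>C a"
    and scaleC_scaleC: "z *\<^sub>C (w *\<^sub>C a) = (z * w) *\<^sub>C a"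
    and mult_scaleC_left: "(z *\<^sub>C a) * b = z *\<^sub>C (a * b)"
    and mult_scaleC_right: "a * (z *\<^sub>C b) = z *\<^sub>C (a * b)"
    and norm_scaleC: "norm (z *\<^sub>C a) = cmod z * norm a"
    and star_star: "star (star a) = a"
    and star_add: "star (a + b) = star a + star b"
    and star_scaleC: "star (z *\<^sub>C a) = cnj z *\<^sub>C star a"
    and star_mult: "star (a * b) = star b * star a"
    and cstar_identity: "norm (star a * a) = (norm a)\<^sup>2"

instantiation complex :: cstar_algebra
begin

definition scaleC_complex :: "complex \<Rightarrow> complex \<Rightarrow> complex"
  where "scaleC_complex z a = z * a"

definition star_complex :: "complex \<Rightarrow> complex"
  where "star_complex a = cnj a"

instance
  by standard
    (auto simp: scaleC_complex_def star_complex_def scaleR_conv_of_real algebra_simps norm_mult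
      power2_eq_square)

end

definition spectrum :: "'a::cstar_algebra \<Rightarrow> complex set"
  where "spectrum a = {z. \<not> (\<exists>b. (z *\<^sub>C 1 - a) * b = 1 \<and> b * (z *\<^sub>C 1 - a) = 1)}"

definition cstar_positive :: "'a::cstar_algebra \<Rightarrow> bool"
  where "cstar_positive a \<longleftrightarrow> star a = a \<and> spectrum a \<subseteq> {complex_of_real r | r. r \<ge> 0}"

definition cstar_le :: "'a::cstar_algebra \<Rightarrow> 'a \<Rightarrow> bool"  (infix "\<le>\<^sub>A" 50)
  where "a \<le>\<^sub>A b \<longleftrightarrow> cstar_positive (b - a)"

text \<open>The second factor carries the star on the right, so for a matrix \<open>A\<close> the form
  \<open>ainner (A *v x) x\<close> is the sum of the terms \<open>A $ j $ k * x $ k * star (x $ j)\<close>. When the algebra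
  is not commutative this differs from the form with terms \<open>star (x $ j) * A $ j $ k * x $ k\<close>
  of Hilbert C*-module theory.\<close>

definition ainner :: "'a::cstar_algebra ^ 'n \<Rightarrow> 'a ^ 'n \<Rightarrow> 'a"
  where "ainner x y = (\<Sum>j\<in>UNIV. x $ j * star (y $ j))"

definition adjoint_mat :: "'a::cstar_algebra ^ 'n ^ 'm \<Rightarrow> 'a ^ 'm ^ 'n"
  where "adjoint_mat A = (\<chi> j k. star (A $ k $ j))"

definition positive_mat :: "'a::cstar_algebra ^ 'n ^ 'n \<Rightarrow> bool"
  where "positive_mat A \<longleftrightarrow> A = adjoint_mat A \<and> (\<forall>x. 0 \<le>\<^sub>A ainner (A *v x) x)"

definition succeq_mat :: "'a::cstar_algebra ^ 'n ^ 'n \<Rightarrow> 'a ^ 'n ^ 'n \<Rightarrow> bool"  (infix "\<succeq>" 50)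
  where "A \<succeq> B \<longleftrightarrow> positive_mat A \<and> positive_mat B \<and> positive_mat (A - B)"

definition outer_star :: "'a::cstar_algebra ^ 'n \<Rightarrow> 'a ^ 'n ^ 'n"
  where "outer_star y = (\<chi> j k. y $ j * star (y $ k))"

end

theory Submission
  imports Defs "HOL-Computational_Algebra.Formal_Power_Series"
begin

text \<open>The inequality rests on two facts.

First, the hypothesis on \<open>A\<close> is much stronger than it looks when the algebra is not commutative. In
\<open>ainner (A *v x) x\<close> the entries of \<open>x\<close> and \<open>star x\<close> stand side by side, to the right of the entries
of \<open>A\<close>, so that requiring all these values to be self-adjoint forces every entry of \<open>A\<close> to commute
with every element of the algebra: polarise the identity \<open>star F = F\<close> for \<open>F x = ainner (A *v x) x\<close>
and evaluate at vectors with one nonzero entry (\<open>positive_mat_entry_central\<close>).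

Second, for a matrix \<open>B\<close> with central entries the form of \<open>B ** adjoint_mat B\<close> at \<open>x\<close> can be
rearranged into a sum of terms \<open>z * star z\<close>, which are positive
(\<open>positive_mat_mult_adjoint_central\<close>). Writing \<open>Y\<close> for the matrix all of whose columns are \<open>y / n\<close>,
each of the three matrices \<open>M\<close>, \<open>y y* / n\<close> and \<open>M - y y* / n\<close> has the form \<open>B ** adjoint_mat B\<close>,
with \<open>B\<close> equal to \<open>A\<close>, \<open>Y\<close> and \<open>A - Y\<close>. The last case holds because \<open>Y = A J / n\<close> for the
all-ones matrix \<open>J\<close> and \<open>P = 1 - J / n\<close> is a projection: \<open>A - Y = A P\<close> and \<open>A P A* = A A* - y y* / n\<close>.

The analytic core is therefore that sums of elements \<open>z * star z\<close> have spectrum in the nonnegative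
reals, proved here from the axioms alone. The spectral definition of positivity is awkward for
sums, so the work is done with the convex cone \<open>norm_pos\<close> of self-adjoint \<open>a\<close> that satisfy
\<open>norm (t - a) \<le> t\<close> for some \<open>t\<close>; it is contained in the spectrally positive elements because
self-adjoint elements have real spectrum and the Neumann series inverts elements close to a
nonzero scalar. Arguing inside the cone avoids the spectral radius formula. The
binomial series for \<open>sqrt (1 - b)\<close> converges absolutely even for \<open>norm b = 1\<close>, so elements of the
cone have square roots in the cone. Conversely squares of self-adjoint elements lie in the cone:
for \<open>norm b \<le> 1\<close> the element \<open>b + i sqrt (1 - b\<^sup>2)\<close> is unitary, which bounds the norm of
\<open>1 - b\<^sup>2\<close> by 1. With square roots at hand, \<open>z * star z\<close> is shown to equal its own absolute value
(\<open>norm_pos_mult_star\<close>).\<close>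

section \<open>Scalars and the involution\<close>

lemma scaleC_zero_right [simp]: "z *\<^sub>C (0::'a::cstar_algebra) = 0"
  using scaleC_add_right[of z "0::'a" 0] by simp

lemma scaleC_minus_right: "z *\<^sub>C (- a) = - (z *\<^sub>C (a::'a::cstar_algebra))"
  using scaleC_add_right[of z a "- a"] by (simp add: eq_neg_iff_add_eq_0 add.commute)

lemma scaleC_minus_left: "(- z) *\<^sub>C a = - (z *\<^sub>C (a::'a::cstar_algebra))"
  using scaleC_scaleC[of "-1" z a] scaleC_of_real[of "-1" "z *\<^sub>C a"] by simp

lemma scaleC_one [simp]: "1 *\<^sub>C a = (a::'a::cstar_algebra)"
  using scaleC_of_real[of 1 a] by simp

lemma scaleC_i_i [simp]: "\<i> *\<^sub>C \<i> *\<^sub>C a = - (a::'a::cstar_algebra)"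
  using scaleC_minus_left[of 1 a] by (simp add: scaleC_scaleC)

lemma scaleC_diff_right: "z *\<^sub>C (a - b) = z *\<^sub>C a - z *\<^sub>C (b::'a::cstar_algebra)"
  using scaleC_add_right[of z a "- b"] by (simp add: scaleC_minus_right)

lemma scaleC_scaleR: "z *\<^sub>C (r *\<^sub>R a) = r *\<^sub>R (z *\<^sub>C (a::'a::cstar_algebra))"
  by (simp add: scaleC_scaleC mult.commute flip: scaleC_of_real)

lemma star_i: "star (\<i> *\<^sub>C a) = - (\<i> *\<^sub>C star (a::'a::cstar_algebra))"
  by (simp add: star_scaleC scaleC_minus_left)

lemma star_scaleR [simp]: "star (r *\<^sub>R a) = r *\<^sub>R star (a::'a::cstar_algebra)"
  using star_scaleC[of "complex_of_real r" a] by (simp add: scaleC_of_real)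

lemma star_zero [simp]: "star (0::'a::cstar_algebra) = 0"
  using star_scaleR[of 0 "0::'a"] by simp

lemma star_minus [simp]: "star (- a) = - star (a::'a::cstar_algebra)"
  using star_scaleR[of "-1" a] by simp

lemma star_diff: "star (a - b) = star a - star (b::'a::cstar_algebra)"
  using star_add[of a "- b"] by simp

lemma star_one [simp]: "star (1::'a::cstar_algebra) = 1"
  by (metis mult.right_neutral star_mult star_star mult.left_neutral)

lemma star_of_real [simp]: "star (of_real r) = (of_real r::'a::cstar_algebra)"
  by (simp add: of_real_def)

lemma star_power: "star (a ^ n) = star (a::'a::cstar_algebra) ^ n"
  by (induction n) (simp_all add: star_mult power_commutes)

lemma star_sum: "star (sum f A) = (\<Sum>i\<in>A. star (f i :: 'a::cstar_algebra))"
  by (induction A rule: infinite_finite_induct) (simp_all add: star_add)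

text \<open>The C*-identity gives \<open>norm b\<^sup>2 \<le> norm (star b) * norm b\<close>, hence one inequality, which
  applied to \<open>star b\<close> yields the other.\<close>

lemma norm_star [simp]: "norm (star a) = norm (a::'a::cstar_algebra)"
proof -
  have le: "norm b \<le> norm (star b)" for b :: 'a
  proof (cases "b = 0")
    case False
    have "norm b * norm b \<le> norm (star b) * norm b"
      using norm_mult_ineq[of "star b" b] by (simp add: cstar_identity power2_eq_square)
    then show ?thesis using False by simp
  qed simp
  show ?thesis using le[of a] le[of "star a"] by (simp add: star_star)
qed

lemma bounded_linear_star: "bounded_linear (star :: 'a::cstar_algebra \<Rightarrow> 'a)"
  by (rule bounded_linear_intro[where K = 1]) (simp_all add: star_add)

text \<open>The sum of squares factors as \<open>star v * v\<close> with \<open>v = x + i y\<close>, so \<open>v = 0\<close> by the C*-identity, and a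
  self-adjoint \<open>x\<close> with \<open>x = - i y\<close> and \<open>x = i y\<close> vanishes. This replaces the spectral argument that a
  cone of positive elements contains no line.\<close>

lemma commuting_squares_sum_zero:
  fixes x y :: "'a::cstar_algebra"
  assumes "star x = x" "star y = y" "x * y = y * x" "x * x + y * y = 0"
  shows "x = 0"
proof -
  define v where "v = x + \<i> *\<^sub>C y"
  have sv: "star v = x - \<i> *\<^sub>C y"
    by (simp add: v_def star_add star_i assms)
  have "star v * v = x * x + y * y"
    unfolding sv by (simp add: v_def algebra_simps mult_scaleC_left mult_scaleC_right scaleC_diff_right scaleC_add_right assms(3))
  then have "v = 0"
    using assms(4) cstar_identity[of v] by simp
  then have "x + \<i> *\<^sub>C y = 0" "x - \<i> *\<^sub>C y = 0"
    using sv by (simp_all add: v_def)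
  then have "x + x = 0" by (metis add_diff_cancel_left' add.right_neutral add_diff_eq diff_add_cancel diff_0_right)
  then have "2 *\<^sub>R x = 0" by (simp add: scaleR_2)
  then show ?thesis by simp
qed

text \<open>Expand in the real and imaginary parts of \<open>c\<close>: the mixed terms of \<open>star c * c\<close> and \<open>c * star c\<close>
  cancel. This links the positivity of the two products.\<close>

lemma star_mult_self_add:
  fixes c :: "'a::cstar_algebra"
  obtains x y where "star x = x" "star y = y" "star c * c + c * star c = 2 *\<^sub>R (x * x + y * y)"
proof -
  define x where "x = (1/2) *\<^sub>R (c + star c)"
  define y where "y = (1/2) *\<^sub>R (\<i> *\<^sub>C (star c - c))"
  have x: "star x = x" by (simp add: x_def star_add star_star add.commute)
  have y: "star y = y"
    by (simp add: y_def star_i star_diff star_star flip: scaleC_minus_right)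
  have "x * x = (1/4) *\<^sub>R ((c + star c) * (c + star c))" by (simp add: x_def)
  moreover have "y * y = (1/4) *\<^sub>R (- ((star c - c) * (star c - c)))"
    by (simp add: y_def mult_scaleC_left mult_scaleC_right scaleC_scaleR)
  ultimately have "2 *\<^sub>R (x * x + y * y)
     = (1/2) *\<^sub>R ((c + star c) * (c + star c) - (star c - c) * (star c - c))"
    by (simp add: scaleR_add_right scaleR_diff_right)
  also have "(c + star c) * (c + star c) - (star c - c) * (star c - c) = 2 *\<^sub>R (star c * c + c * star c)"
    by (simp add: algebra_simps scaleR_2)
  finally show ?thesis using that[OF x y] by simp
qed

section \<open>The spectrum\<close>

lemma one_minus_invertible:
  fixes x :: "'a::{real_normed_algebra_1,banach}"
  assumes "norm x < 1"
  shows "\<exists>b. (1 - x) * b = 1 \<and> b * (1 - x) = 1"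
proof -
  have s: "summable (\<lambda>n. x ^ n)" by (rule complete_algebra_summable_geometric[OF assms])
  let ?b = "\<Sum>n. x ^ n"
  have "x * ?b = (\<Sum>n. x ^ Suc n)"
    using suminf_mult[OF s, of x] by simp
  moreover have "?b * x = (\<Sum>n. x ^ Suc n)"
    using suminf_mult2[OF s, of x] by (simp add: power_commutes)
  moreover have "(\<Sum>n. x ^ Suc n) = ?b - 1"
    using suminf_split_head[OF s] by simp
  ultimately show ?thesis
    by (intro exI[of _ ?b]) (simp add: algebra_simps)
qed

text \<open>Write \<open>z - a\<close> as \<open>(z - w) + (w - a)\<close>; the first summand is a scalar that dominates the second
  in norm, so the Neumann series applies.\<close>

lemma not_in_spectrum_if_near:
  fixes a :: "'a::cstar_algebra"
  assumes "norm (w *\<^sub>C 1 - a) < cmod (z - w)"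
  shows "z \<notin> spectrum a"
proof -
  define d where "d = z - w"
  have d: "d \<noteq> 0" using assms by (auto simp: d_def)
  define x where "x = (- inverse d) *\<^sub>C (w *\<^sub>C 1 - a)"
  have "norm x = norm (w *\<^sub>C 1 - a) / cmod d"
    by (simp add: x_def norm_scaleC norm_inverse divide_inverse_commute)
  then have "norm x < 1" using assms d by (simp add: d_def)
  then obtain b where b: "(1 - x) * b = 1" "b * (1 - x) = 1"
    using one_minus_invertible by blast
  have "d *\<^sub>C (1 - x) = d *\<^sub>C 1 + d *\<^sub>C (- x)"
    by (metis scaleC_add_right diff_conv_add_uminus)
  also have "d *\<^sub>C (- x) = w *\<^sub>C 1 - a"
    using d by (simp add: x_def scaleC_minus_right scaleC_minus_left scaleC_scaleC)
  also have "d *\<^sub>C 1 + (w *\<^sub>C 1 - a) = z *\<^sub>C 1 - a"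
    using scaleC_add_left[of d w "1::'a"] by (simp add: d_def)
  finally have e: "z *\<^sub>C 1 - a = d *\<^sub>C (1 - x)" by simp
  have "(z *\<^sub>C 1 - a) * (inverse d *\<^sub>C b) = 1" "(inverse d *\<^sub>C b) * (z *\<^sub>C 1 - a) = 1"
    using d b by (simp_all add: e mult_scaleC_left mult_scaleC_right scaleC_scaleC)
  then show ?thesis by (auto simp: spectrum_def)
qed

text \<open>Compare \<open>a\<close> with a purely imaginary scalar \<open>i t\<close>. By the C*-identity \<open>norm (i t - a)\<^sup>2\<close> is at most
  \<open>t\<^sup>2 + (norm a)\<^sup>2\<close>, whereas the squared distance from \<open>i t\<close> to a nonreal \<open>z\<close> exceeds \<open>t\<^sup>2\<close> by a
  quantity linear in \<open>t\<close>, unbounded when \<open>t\<close> runs away from \<open>z\<close>.\<close>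

lemma spectrum_selfadjoint_real:
  fixes a :: "'a::cstar_algebra"
  assumes "star a = a" "z \<in> spectrum a"
  shows "Im z = 0"
proof (rule ccontr)
  assume nz: "Im z \<noteq> 0"
  \<comment> \<open>chosen so that the cross term \<open>- 2 * Im z * t\<close> of \<open>(Im z - t)\<^sup>2\<close> is \<open>(norm a)\<^sup>2 + 1\<close>\<close>
  define t where "t = - ((norm a)\<^sup>2 + 1) / (2 * Im z)"
  let ?w = "\<i> * complex_of_real t"
  let ?v = "?w *\<^sub>C 1 - a"
  have w1: "?w *\<^sub>C 1 = t *\<^sub>R (\<i> *\<^sub>C (1::'a))"
    by (metis scaleC_scaleC scaleC_of_real mult.commute)
  have sv: "star ?v = - (t *\<^sub>R (\<i> *\<^sub>C 1)) - a"
    unfolding w1 by (simp add: star_diff star_i assms)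
  have "star ?v * ?v = (t * t) *\<^sub>R 1 + a * a"
    unfolding sv unfolding w1
    by (simp add: algebra_simps mult_scaleC_left mult_scaleC_right scaleC_diff_right
        scaleC_minus_right scaleC_scaleR)
  then have "(norm ?v)\<^sup>2 = norm ((t * t) *\<^sub>R 1 + a * a)"
    by (metis cstar_identity)
  also have "\<dots> \<le> t\<^sup>2 + (norm a)\<^sup>2"
    by (rule norm_triangle_le) (simp add: power2_eq_square norm_mult_ineq)
  also have "\<dots> < (Re z)\<^sup>2 + (Im z - t)\<^sup>2"
  proof -
    have "2 * Im z * t = - ((norm a)\<^sup>2 + 1)" using nz by (simp add: t_def)
    then have "(Im z - t)\<^sup>2 = (Im z)\<^sup>2 + (norm a)\<^sup>2 + 1 + t\<^sup>2"
      by (simp add: power2_diff)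
    then show ?thesis using zero_le_power2[of "Re z"] zero_le_power2[of "Im z"] by linarith
  qed
  also have "\<dots> = (cmod (z - ?w))\<^sup>2" by (simp add: cmod_power2)
  finally have "norm ?v < cmod (z - ?w)" by (rule power2_less_imp_less) simp
  from not_in_spectrum_if_near[OF this] assms(2) show False by contradiction
qed

section \<open>A cone of positive elements described by norms\<close>

text \<open>For self-adjoint \<open>a\<close> the bound confines the spectrum to the disc of radius \<open>t\<close> around \<open>t\<close>, hence to
  the interval from \<open>0\<close> to \<open>2 t\<close>.\<close>

definition pos_within :: "real \<Rightarrow> 'a::cstar_algebra \<Rightarrow> bool"
  where "pos_within t a \<longleftrightarrow> star a = a \<and> norm (of_real t - a) \<le> t"

text \<open>Enlarging \<open>t\<close> is allowed by the triangle inequality, so that several elements can share one bound.\<close>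

lemma pos_within_mono:
  assumes "pos_within s a" "s \<le> t"
  shows "pos_within t (a::'a::cstar_algebra)"
proof -
  have "norm (of_real (t - s) + (of_real s - a)) \<le> (t - s) + s"
    using assms by (intro norm_triangle_le) (simp add: pos_within_def del: of_real_diff)
  then show ?thesis using assms by (simp add: pos_within_def)
qed

text \<open>Only positive \<open>t\<close> are considered, because elements are rescaled by \<open>1 / t\<close> to form square roots.\<close>

definition norm_pos :: "'a::cstar_algebra \<Rightarrow> bool"
  where "norm_pos a \<longleftrightarrow> (\<exists>t>0. pos_within t a)"

lemma norm_posI: "pos_within t (a::'a::cstar_algebra) \<Longrightarrow> norm_pos a"
  unfolding norm_pos_def using pos_within_mono[of t a "max t 1"] by (intro exI[of _ "max t 1"]) simp

lemma norm_pos_common: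
  assumes "norm_pos a" "norm_pos b"
  obtains t where "0 < t" "pos_within t a" "pos_within t b"
proof -
  from assms obtain s t where st: "0 < s" "0 < t" "pos_within s a" "pos_within t b"
    by (auto simp: norm_pos_def)
  show ?thesis using st
    by (intro that[of "max s t"]) (auto intro: pos_within_mono)
qed

lemma norm_pos_star: "norm_pos a \<Longrightarrow> star a = a"
  by (auto simp: norm_pos_def pos_within_def)

lemma norm_pos_zero: "norm_pos 0"
  by (rule norm_posI[of 0]) (simp add: pos_within_def)

text \<open>Here the description by norms pays off: the triangle inequality adds the bounds.\<close>

lemma norm_pos_add:
  assumes "norm_pos a" "norm_pos b"
  shows "norm_pos (a + b)"
proof -
  obtain s t where s: "pos_within s a" and t: "pos_within t b"
    using assms by (auto simp: norm_pos_def)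
  have "norm ((of_real s - a) + (of_real t - b)) \<le> s + t"
    using s t by (intro norm_triangle_mono) (auto simp: pos_within_def)
  then have "pos_within (s + t) (a + b)"
    using s t by (simp add: pos_within_def star_add algebra_simps)
  then show ?thesis by (rule norm_posI)
qed

lemma norm_pos_scaleR:
  assumes "norm_pos a" "0 \<le> r"
  shows "norm_pos (r *\<^sub>R a)"
proof -
  obtain t where t: "pos_within t a" using assms by (auto simp: norm_pos_def)
  have "of_real (r * t) - r *\<^sub>R a = r *\<^sub>R (of_real t - a)"
    by (simp add: scaleR_diff_right of_real_def)
  then have "pos_within (r * t) (r *\<^sub>R a)"
    using t assms by (simp add: pos_within_def mult_left_mono)
  then show ?thesis by (rule norm_posI)
qed

lemma norm_pos_sum: "(\<And>i. i \<in> A \<Longrightarrow> norm_pos (f i)) \<Longrightarrow> norm_pos (sum f A)"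
  by (induction A rule: infinite_finite_induct) (auto intro: norm_pos_zero norm_pos_add)

text \<open>A negative \<open>z\<close> is further than \<open>t\<close> away from \<open>t\<close>, so it cannot belong to the spectrum.\<close>

lemma norm_pos_imp_cstar_positive:
  assumes "norm_pos a"
  shows "cstar_positive a"
  unfolding cstar_positive_def
proof (intro conjI subsetI)
  show sa: "star a = a" by (rule norm_pos_star[OF assms])
  fix z assume z: "z \<in> spectrum a"
  obtain t where t: "0 < t" "norm (of_real t - a) \<le> t"
    using assms by (auto simp: norm_pos_def pos_within_def)
  have im: "Im z = 0" by (rule spectrum_selfadjoint_real[OF sa z])
  have "0 \<le> Re z"
  proof (rule ccontr)
    assume "\<not> 0 \<le> Re z"
    have "norm (complex_of_real t *\<^sub>C 1 - a) \<le> t"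
      using t by (simp add: scaleC_of_real flip: of_real_def)
    also have "t < \<bar>Re (z - of_real t)\<bar>" using \<open>\<not> 0 \<le> Re z\<close> t by simp
    also have "\<dots> \<le> cmod (z - of_real t)" by (rule abs_Re_le_cmod)
    finally show False using not_in_spectrum_if_near z by blast
  qed
  then show "z \<in> {complex_of_real r | r. r \<ge> 0}"
    using im by (auto simp: complex_eq_iff intro!: exI[of _ "Re z"])
qed

section \<open>The binomial series for the square root\<close>

text \<open>The Taylor coefficients of \<open>sqrt (1 - x)\<close> at \<open>0\<close>.\<close>

definition sqrt_coeff :: "nat \<Rightarrow> real"
  where "sqrt_coeff k = (1/2 gchoose k) * (-1) ^ k"

lemma sqrt_coeff_0 [simp]: "sqrt_coeff 0 = 1"
  by (simp add: sqrt_coeff_def)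

lemma minus_one_power_gchoose: "(a gchoose k) * (-1) ^ k = pochhammer (- a) k / fact k" for a :: real
proof -
  have "(-1::real) ^ k * (-1) ^ k = 1" by (simp flip: power_mult_distrib)
  then show ?thesis by (simp add: gbinomial_pochhammer)
qed

lemma sqrt_coeff_Suc_nonpos: "sqrt_coeff (Suc k) \<le> 0"
  unfolding sqrt_coeff_def minus_one_power_gchoose
  by (simp add: pochhammer_rec mult_nonpos_nonneg divide_nonpos_pos pochhammer_nonneg)

text \<open>The partial sums at \<open>x = 1\<close> have a closed form, which gives absolute convergence on the closed unit
  ball: all coefficients but the first are nonpositive, so a lower bound for the partial sums bounds
  the sum of their absolute values.\<close>

lemma sum_sqrt_coeff_nonneg: "0 \<le> (\<Sum>k\<le>n. sqrt_coeff k)"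
proof -
  have "(\<Sum>k\<le>n. sqrt_coeff k) = (-1/2 gchoose n) * (-1) ^ n"
    unfolding sqrt_coeff_def gbinomial_sum_lower_neg by simp
  then show ?thesis
    unfolding minus_one_power_gchoose by (simp add: pochhammer_nonneg)
qed

lemma sum_abs_sqrt_coeff_le: "(\<Sum>k<n. \<bar>sqrt_coeff (Suc k)\<bar>) \<le> 1"
proof -
  have "(\<Sum>k\<le>n. sqrt_coeff k) = 1 + (\<Sum>k<n. sqrt_coeff (Suc k))"
    by (simp add: sum.atMost_shift)
  moreover have "(\<Sum>k<n. \<bar>sqrt_coeff (Suc k)\<bar>) = - (\<Sum>k<n. sqrt_coeff (Suc k))"
    by (simp add: abs_of_nonpos[OF sqrt_coeff_Suc_nonpos] sum_negf)
  ultimately show ?thesis using sum_sqrt_coeff_nonneg[of n] by simp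
qed

lemma summable_abs_sqrt_coeff_Suc: "summable (\<lambda>k. \<bar>sqrt_coeff (Suc k)\<bar>)"
  by (rule summableI_nonneg_bounded[OF _ sum_abs_sqrt_coeff_le]) simp

text \<open>The coefficients of the square of the series, which is \<open>1 - x\<close>, by Vandermonde convolution.\<close>

lemma sqrt_coeff_convolution:
  "(\<Sum>i\<le>k. sqrt_coeff i * sqrt_coeff (k - i)) = (if k = 0 then 1 else if k = 1 then -1 else 0)"
proof -
  have "(\<Sum>i\<le>k. sqrt_coeff i * sqrt_coeff (k - i))
      = (\<Sum>i\<le>k. (-1) ^ k * ((1/2 gchoose i) * (1/2 gchoose (k - i))))"
    by (rule sum.cong) (auto simp: sqrt_coeff_def mult_ac simp flip: power_add)
  also have "\<dots> = (-1) ^ k * (of_nat 1 gchoose k)"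
    using gbinomial_Vandermonde[of "1/2::real" "1/2" k]
    by (simp add: sum_distrib_left[symmetric] atLeast0AtMost)
  also have "\<dots> = (if k = 0 then 1 else if k = 1 then -1 else 0)"
    unfolding binomial_gbinomial[symmetric] by (auto simp: binomial_eq_0)
  finally show ?thesis .
qed

definition sqrt_one_minus :: "'a::{real_normed_algebra_1,banach} \<Rightarrow> 'a"
  where "sqrt_one_minus b = (\<Sum>k. sqrt_coeff k *\<^sub>R b ^ k)"

context
  fixes b :: "'a::{real_normed_algebra_1,banach}"
  assumes b: "norm b \<le> 1"
begin

lemma norm_sqrt_term_le: "norm (sqrt_coeff k *\<^sub>R b ^ k) \<le> \<bar>sqrt_coeff k\<bar>"
proof -
  have "norm (b ^ k) \<le> 1"
    using norm_power_ineq[of b k] power_le_one[OF norm_ge_zero b, of k] by linarith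
  then show ?thesis by (simp add: mult_left_le)
qed

lemma summable_norm_sqrt_terms: "summable (\<lambda>k. norm (sqrt_coeff k *\<^sub>R b ^ k))"
proof (rule summable_comparison_test)
  show "summable (\<lambda>k. \<bar>sqrt_coeff k\<bar>)"
    using summable_abs_sqrt_coeff_Suc summable_Suc_iff by blast
  show "\<exists>N. \<forall>k\<ge>N. norm (norm (sqrt_coeff k *\<^sub>R b ^ k)) \<le> \<bar>sqrt_coeff k\<bar>"
    using norm_sqrt_term_le by simp
qed

lemmas summable_sqrt_terms = summable_norm_cancel[OF summable_norm_sqrt_terms]

text \<open>Since the absolute values of the coefficients after the first add up to at most 1, the square root
  stays within distance 1 of the unit. This is why square roots remain in the cone.\<close>

lemma norm_one_minus_sqrt_one_minus_le: "norm (1 - sqrt_one_minus b) \<le> 1"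
proof -
  have "norm (\<Sum>k. sqrt_coeff (Suc k) *\<^sub>R b ^ Suc k) \<le> (\<Sum>k. \<bar>sqrt_coeff (Suc k)\<bar>)"
    by (rule norm_suminf_le[OF norm_sqrt_term_le summable_abs_sqrt_coeff_Suc])
  also have "\<dots> \<le> 1"
    by (rule suminf_le_const[OF summable_abs_sqrt_coeff_Suc sum_abs_sqrt_coeff_le])
  finally show ?thesis
    using suminf_split_head[OF summable_sqrt_terms]
    by (simp add: sqrt_one_minus_def norm_minus_commute)
qed

lemma sqrt_one_minus_mult_self: "sqrt_one_minus b * sqrt_one_minus b = 1 - b"
proof -
  have "(\<Sum>i\<le>k. (sqrt_coeff i *\<^sub>R b ^ i) * (sqrt_coeff (k - i) *\<^sub>R b ^ (k - i)))
      = (\<Sum>i\<le>k. sqrt_coeff i * sqrt_coeff (k - i)) *\<^sub>R b ^ k" for k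
    unfolding scaleR_sum_left by (rule sum.cong) (auto simp flip: power_add)
  then have "sqrt_one_minus b * sqrt_one_minus b
      = (\<Sum>k. (if k = 0 then 1 else if k = 1 then -1 else (0::real)) *\<^sub>R b ^ k)"
    unfolding sqrt_one_minus_def
    by (simp only: Cauchy_product[OF summable_norm_sqrt_terms summable_norm_sqrt_terms]
          sqrt_coeff_convolution)
  also have "\<dots> = (\<Sum>k\<in>{0, 1}. (if k = 0 then 1 else if k = 1 then -1 else (0::real)) *\<^sub>R b ^ k)"
    by (rule suminf_finite) auto
  finally show ?thesis by simp
qed

end

text \<open>Stated for an intertwining relation rather than for commutation because it is later applied to
  \<open>b\<close> and \<open>b'\<close> built from \<open>star c * c\<close> and \<open>c * star c\<close>.\<close>

lemma sqrt_one_minus_intertwine: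
  fixes b b' c :: "'a::{real_normed_algebra_1,banach}"
  assumes "norm b \<le> 1" "norm b' \<le> 1" "c * b = b' * c"
  shows "c * sqrt_one_minus b = sqrt_one_minus b' * c"
proof -
  have "c * b ^ k = b' ^ k * c" for k
  proof (induction k)
    case (Suc k)
    have "c * b ^ Suc k = b' * (c * b ^ k)" by (simp add: assms(3) flip: mult.assoc)
    then show ?case by (simp add: Suc mult.assoc)
  qed simp
  then have "(\<lambda>k. c * (sqrt_coeff k *\<^sub>R b ^ k)) = (\<lambda>k. (sqrt_coeff k *\<^sub>R b' ^ k) * c)"
    by simp
  then show ?thesis
    unfolding sqrt_one_minus_def
    using suminf_mult[OF summable_sqrt_terms[OF assms(1)], of c]
      suminf_mult2[OF summable_sqrt_terms[OF assms(2)], of c] by simp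
qed

lemma star_sqrt_one_minus:
  fixes b :: "'a::cstar_algebra"
  assumes "norm b \<le> 1" "star b = b"
  shows "star (sqrt_one_minus b) = sqrt_one_minus b"
  unfolding sqrt_one_minus_def
  using bounded_linear.suminf[OF bounded_linear_star summable_sqrt_terms[OF assms(1)]] assms(2)
  by (simp add: star_power)

section \<open>Square roots in the cone\<close>

text \<open>The scale \<open>t\<close> is kept as a parameter: the series centred at \<open>t\<close> depends on it formally, and
  intertwining two square roots requires that both use the same series.\<close>

definition sqrt_at :: "real \<Rightarrow> 'a::cstar_algebra \<Rightarrow> 'a"
  where "sqrt_at t a = sqrt t *\<^sub>R sqrt_one_minus (1 - a /\<^sub>R t)"

lemma pos_within_normalized:
  assumes "0 < t" "pos_within t (a::'a::cstar_algebra)"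
  shows "norm (1 - a /\<^sub>R t) \<le> 1"
proof -
  have "1 - a /\<^sub>R t = (of_real t - a) /\<^sub>R t"
    using assms by (simp add: scaleR_diff_right of_real_def)
  then have "norm (1 - a /\<^sub>R t) = norm (of_real t - a) / t"
    using assms(1) by (simp add: divide_inverse_commute)
  then show ?thesis using assms by (simp add: pos_within_def)
qed

lemma sqrt_at_intertwine:
  fixes a a' c :: "'a::cstar_algebra"
  assumes "0 < t" "pos_within t a" "pos_within t a'" "c * a = a' * c"
  shows "c * sqrt_at t a = sqrt_at t a' * c"
proof -
  have "c * (1 - a /\<^sub>R t) = (1 - a' /\<^sub>R t) * c"
    using assms(4) by (simp add: algebra_simps)
  from sqrt_one_minus_intertwine[OF pos_within_normalized[OF assms(1,2)]
      pos_within_normalized[OF assms(1,3)] this]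
  show ?thesis by (simp add: sqrt_at_def)
qed

lemma sqrt_at_mult_self:
  fixes a :: "'a::cstar_algebra"
  assumes "0 < t" "pos_within t a"
  shows "sqrt_at t a * sqrt_at t a = a"
  using sqrt_one_minus_mult_self[OF pos_within_normalized[OF assms]] assms(1)
  by (simp add: sqrt_at_def flip: mult.assoc)

lemma star_sqrt_at:
  fixes a :: "'a::cstar_algebra"
  assumes "0 < t" "pos_within t a"
  shows "star (sqrt_at t a) = sqrt_at t a"
  using star_sqrt_one_minus[OF pos_within_normalized[OF assms]] assms(2)
  by (simp add: sqrt_at_def star_diff pos_within_def)

lemma norm_pos_sqrt_at:
  fixes a :: "'a::cstar_algebra"
  assumes "0 < t" "pos_within t a"
  shows "norm_pos (sqrt_at t a)"
proof (rule norm_posI)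
  have "of_real (sqrt t) - sqrt_at t a = sqrt t *\<^sub>R (1 - sqrt_one_minus (1 - a /\<^sub>R t))"
    by (simp add: sqrt_at_def scaleR_diff_right of_real_def)
  then show "pos_within (sqrt t) (sqrt_at t a)"
    using norm_one_minus_sqrt_one_minus_le[OF pos_within_normalized[OF assms]] assms(1)
    by (simp add: pos_within_def star_sqrt_at[OF assms] mult_left_le)
qed

lemma norm_pos_sqrtE:
  fixes a :: "'a::cstar_algebra"
  assumes "norm_pos a"
  obtains r where "norm_pos r" "r * r = a" "\<And>c. c * a = a * c \<Longrightarrow> c * r = r * c"
proof -
  obtain t where t: "0 < t" "pos_within t a" using assms by (auto simp: norm_pos_def)
  show ?thesis
    by (rule that[OF norm_pos_sqrt_at[OF t] sqrt_at_mult_self[OF t] sqrt_at_intertwine[OF t(1) t(2) t(2)]])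
qed

lemma mult_mult_commute_middle:
  fixes a b c :: "'a::semigroup_mult"
  assumes "a * b = b * a"
  shows "(a * b) * (a * c) = (a * a) * (b * c)"
proof -
  have "(a * b) * (a * c) = a * (b * a) * c" by (simp only: mult.assoc)
  also have "\<dots> = a * (a * b) * c" by (simp only: assms)
  finally show ?thesis by (simp only: mult.assoc)
qed

text \<open>With \<open>d = p - r\<close> and square roots \<open>u\<close>, \<open>v\<close> of \<open>p\<close>, \<open>r\<close>, the vanishing of \<open>d (p + r)\<close> says that the
  squares of the commuting self-adjoint elements \<open>d u\<close> and \<open>d v\<close> add up to zero. Hence both vanish,
  so \<open>d p = d r = 0\<close> and \<open>d\<^sup>2 = 0\<close>.\<close>

lemma norm_pos_sqrt_unique:
  fixes p r :: "'a::cstar_algebra"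
  assumes "norm_pos p" "norm_pos r" "p * r = r * p" "p * p = r * r"
  shows "p = r"
proof -
  obtain u where u: "norm_pos u" "u * u = p" "\<And>c. c * p = p * c \<Longrightarrow> c * u = u * c"
    using norm_pos_sqrtE[OF assms(1)] by blast
  obtain v where v: "norm_pos v" "v * v = r" "\<And>c. c * r = r * c \<Longrightarrow> c * v = v * c"
    using norm_pos_sqrtE[OF assms(2)] by blast
  define d where "d = p - r"
  have dp: "d * p = p * d" and dr: "d * r = r * d"
    using assms(3) by (simp_all add: d_def algebra_simps)
  have du: "d * u = u * d" and dv: "d * v = v * d" using u(3) v(3) dp dr by blast+
  have "v * p = p * v" using v(3)[of p] assms(3) by simp
  then have vu: "v * u = u * v" using u(3) by blast
  have sd: "star d = d" using assms by (simp add: d_def star_diff norm_pos_star)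
  have su: "star (d * u) = d * u" "star (d * v) = d * v"
    using sd u(1) v(1) du dv by (simp_all add: star_mult norm_pos_star)
  have sq: "(d * u) * (d * u) = d * d * p" "(d * v) * (d * v) = d * d * r"
    by (simp_all only: mult_mult_commute_middle[OF du] mult_mult_commute_middle[OF dv] u(2) v(2))
  have com: "(d * u) * (d * v) = (d * v) * (d * u)"
    by (simp only: mult_mult_commute_middle[OF du] mult_mult_commute_middle[OF dv] vu)
  have dpr: "d * (p + r) = 0" using assms(3,4) by (simp add: d_def algebra_simps)
  have "(d * u) * (d * u) + (d * v) * (d * v) = d * (d * (p + r))"
    unfolding sq by (simp only: distrib_left mult.assoc)
  then have z: "(d * u) * (d * u) + (d * v) * (d * v) = 0" by (simp add: dpr)
  have "d * u = 0" using commuting_squares_sum_zero[OF su com z] .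
  moreover have "d * v = 0"
    using commuting_squares_sum_zero[OF su(2,1) com[symmetric]] z by (simp add: add.commute)
  ultimately have "d * p = 0" "d * r = 0"
    by (simp_all flip: u(2) v(2) mult.assoc)
  moreover have "d * d = d * p - d * r" by (simp add: d_def right_diff_distrib)
  ultimately have "star d * d = 0" using sd by simp
  then have "d = 0" using cstar_identity[of d] by simp
  then show ?thesis by (simp add: d_def)
qed

text \<open>After scaling to norm at most 1, set \<open>s = sqrt (1 - b\<^sup>2)\<close>. Then \<open>b + i s\<close> is unitary, so its
  imaginary part \<open>s\<close> has norm at most 1, and therefore so has \<open>s\<^sup>2 = 1 - b\<^sup>2\<close>.\<close>

lemma norm_pos_square:
  fixes a :: "'a::cstar_algebra"
  assumes a: "star a = a"
  shows "norm_pos (a * a)"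
proof -
  have unit: "norm (1 - b * b) \<le> 1" if b: "star b = b" "norm b \<le> 1" for b :: 'a
  proof -
    have bb: "norm (b * b) \<le> 1"
      using norm_mult_ineq[of b b] mult_mono[OF b(2) b(2)] by simp
    define s where "s = sqrt_one_minus (b * b)"
    have ss: "s * s = 1 - b * b" unfolding s_def by (rule sqrt_one_minus_mult_self[OF bb])
    have st: "star s = s" unfolding s_def by (rule star_sqrt_one_minus[OF bb]) (simp add: star_mult b)
    have bs: "b * s = s * b"
      unfolding s_def by (rule sqrt_one_minus_intertwine[OF bb bb]) (simp add: mult.assoc)
    define u where "u = b + \<i> *\<^sub>C s"
    have su: "star u = b - \<i> *\<^sub>C s" by (simp add: u_def star_add star_i b st)
    have "star u * u = 1"
      unfolding su
      by (simp add: u_def algebra_simps mult_scaleC_left mult_scaleC_right scaleC_diff_right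
          scaleC_add_right bs ss)
    then have "(norm u)\<^sup>2 = 1" using cstar_identity[of u] by simp
    then have nu: "norm u = 1" using norm_ge_zero[of u] by (auto simp: power2_eq_1_iff)
    have "2 *\<^sub>R (\<i> *\<^sub>C s) = u - star u" unfolding su by (simp add: u_def scaleR_2)
    then have "2 * norm (\<i> *\<^sub>C s) = norm (u - star u)" by (metis norm_scaleR abs_numeral)
    also have "\<dots> \<le> 2" using norm_triangle_ineq4[of u "star u"] nu by simp
    finally have "norm s \<le> 1" by (simp add: norm_scaleC)
    then have "norm (s * s) \<le> 1"
      using norm_mult_ineq[of s s] mult_mono[of "norm s" 1 "norm s" 1] by simp
    then show ?thesis by (simp add: ss)
  qed
  show ?thesis
  proof (cases "a = 0")
    case False
    define N where "N = norm a"
    have N: "0 < N" using False by (simp add: N_def)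
    have "N * N * (inverse N * inverse N) = 1" using N by (simp add: field_simps)
    then have "of_real (N * N) - a * a = (N * N) *\<^sub>R (1 - (a /\<^sub>R N) * (a /\<^sub>R N))"
      by (simp add: scaleR_diff_right of_real_def)
    moreover have "norm (1 - (a /\<^sub>R N) * (a /\<^sub>R N)) \<le> 1"
      using N by (intro unit) (simp_all add: a N_def)
    ultimately have "norm (of_real (N * N) - a * a) \<le> N * N"
      using N by (simp add: mult_left_le abs_mult)
    then have "pos_within (N * N) (a * a)" by (simp add: pos_within_def star_mult a)
    then show ?thesis by (rule norm_posI)
  qed (simp add: norm_pos_zero)
qed

section \<open>Positivity of products of an element and its adjoint\<close>

text \<open>Put \<open>p = star c * c\<close> and \<open>q = - c * star c\<close>. Then \<open>p - q\<close> is twice a sum of squares, so \<open>p\<close> lies in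
  the cone together with \<open>q\<close>. From \<open>c p = - q c\<close> follows \<open>c p\<^sup>2 = q\<^sup>2 c\<close>, and taking square roots, which
  are \<open>p\<close> and \<open>q\<close> by uniqueness, gives \<open>c p = q c\<close>. So \<open>q c = 0\<close>. This comparison of signs takes the
  place of the usual appeal to the common nonzero spectrum of \<open>star c * c\<close> and \<open>c * star c\<close>.\<close>

lemma eq_zero_if_neg_mult_star_norm_pos:
  fixes c :: "'a::cstar_algebra"
  assumes "norm_pos (- (c * star c))"
  shows "c = 0"
proof -
  define p q where "p = star c * c" and "q = - (c * star c)"
  have q: "norm_pos q" using assms by (simp add: q_def)
  obtain x y where "star x = x" "star y = y" "star c * c + c * star c = 2 *\<^sub>R (x * x + y * y)"
    using star_mult_self_add by blast
  then have "norm_pos (p + - q)"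
    by (simp add: p_def q_def norm_pos_scaleR norm_pos_add norm_pos_square)
  from norm_pos_add[OF this q] have p: "norm_pos p" by simp
  have cp: "c * p = - (q * c)" by (simp add: p_def q_def mult.assoc)
  have "c * (p * p) = (c * p) * p" by (simp only: mult.assoc)
  also have "\<dots> = - (q * (c * p))" by (simp add: cp mult.assoc)
  also have "\<dots> = (q * q) * c" by (simp add: cp mult.assoc)
  finally have cpp: "c * (p * p) = (q * q) * c" .
  have sq: "norm_pos (p * p)" "norm_pos (q * q)"
    using p q by (auto intro: norm_pos_square norm_pos_star)
  obtain t where t: "0 < t" "pos_within t (p * p)" "pos_within t (q * q)"
    using norm_pos_common[OF sq] by blast
  have sqrt: "sqrt_at t (b * b) = b" if b: "norm_pos b" and tb: "pos_within t (b * b)" for b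
  proof (rule norm_pos_sqrt_unique[OF norm_pos_sqrt_at[OF t(1) tb] b])
    show "sqrt_at t (b * b) * b = b * sqrt_at t (b * b)"
      by (rule sqrt_at_intertwine[OF t(1) tb tb, symmetric]) (simp add: mult.assoc)
  qed (rule sqrt_at_mult_self[OF t(1) tb])
  have "c * p = q * c"
    using sqrt_at_intertwine[OF t cpp] by (simp only: sqrt[OF p t(2)] sqrt[OF q t(3)])
  with cp have "q * c + q * c = 0" by (metis left_minus)
  then have "2 *\<^sub>R (q * c) = 0" by (simp add: scaleR_2)
  then have "q * c = 0" by simp
  moreover have "star q * q = - (q * c * star c)"
    by (simp add: norm_pos_star[OF q]) (simp add: q_def mult.assoc)
  ultimately have "star q * q = 0" by simp
  then have "q = 0" using cstar_identity[of q] by simp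
  then show ?thesis using cstar_identity[of "star c"] by (simp add: q_def star_star)
qed

text \<open>Let \<open>a = z * star z\<close> with absolute value \<open>h = sqrt (a\<^sup>2)\<close>, and let \<open>m = h - a\<close>, twice the negative part.
  Since \<open>m a = - m h\<close>, the element \<open>c = m z\<close> satisfies \<open>c * star c = m a m = - m h m\<close>, minus a square.
  Hence \<open>c = 0\<close>, so \<open>m a = 0 = m h\<close>, which gives \<open>m\<^sup>2 = 0\<close> and \<open>a = h\<close>.\<close>

lemma norm_pos_mult_star:
  fixes z :: "'a::cstar_algebra"
  shows "norm_pos (z * star z)"
proof -
  define a where "a = z * star z"
  have a: "star a = a" by (simp add: a_def star_mult star_star)
  obtain h where h: "norm_pos h" "h * h = a * a" "\<And>c. c * (a * a) = (a * a) * c \<Longrightarrow> c * h = h * c"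
    using norm_pos_sqrtE[OF norm_pos_square[OF a]] by blast
  obtain g where g: "norm_pos g" "g * g = h" "\<And>c. c * h = h * c \<Longrightarrow> c * g = g * c"
    using norm_pos_sqrtE[OF h(1)] by blast
  have ah: "a * h = h * a" by (rule h(3)) (simp add: mult.assoc)
  define m where "m = h - a"
  have m: "star m = m" by (simp add: m_def star_diff a norm_pos_star[OF h(1)])
  have "m * h = h * m" using ah by (simp add: m_def algebra_simps)
  then have mg: "m * g = g * m" by (rule g(3))
  have ma: "m * a = - (m * h)" using ah h(2) by (simp add: m_def algebra_simps)
  have "(m * z) * star (m * z) = m * a * m" by (simp add: star_mult m a_def mult.assoc)
  also have "\<dots> = - (m * (g * g) * m)" by (simp add: ma g(2))
  also have "m * (g * g) * m = (m * g) * (g * m)" by (simp only: mult.assoc)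
  also have "\<dots> = (m * g) * (m * g)" by (simp only: mg)
  finally have "- ((m * z) * star (m * z)) = (m * g) * (m * g)" by simp
  moreover have "norm_pos ((m * g) * (m * g))"
    by (rule norm_pos_square) (simp add: star_mult m norm_pos_star[OF g(1)] mg)
  ultimately have "m * z = 0" using eq_zero_if_neg_mult_star_norm_pos by metis
  then have "m * a = 0" by (simp add: a_def flip: mult.assoc)
  then have "star m * m = 0" using ma by (simp add: m) (simp add: m_def right_diff_distrib)
  then have "m = 0" using cstar_identity[of m] by simp
  then show ?thesis using h(1) by (simp add: m_def a_def)
qed

section \<open>Positive matrices and central entries\<close>

lemma ainner_matrix_vector:
  "ainner (A *v x) y = (\<Sum>j\<in>UNIV. \<Sum>k\<in>UNIV. A $ j $ k * x $ k * star (y $ j))"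
  by (simp add: ainner_def matrix_vector_mult_def sum_distrib_right)

lemma ainner_add_left: "ainner (x + y) z = ainner x z + ainner y z"
  by (simp add: ainner_def distrib_right sum.distrib)

lemma ainner_add_right: "ainner x (y + z) = ainner x y + ainner x z"
  by (simp add: ainner_def distrib_left star_add sum.distrib)

lemma ainner_axis_right: "ainner x (axis j u) = x $ j * star u"
proof -
  have "ainner x (axis j u) = (\<Sum>i\<in>UNIV. if i = j then x $ i * star u else 0)"
    unfolding ainner_def by (rule sum.cong) (auto simp: axis_def)
  then show ?thesis by simp
qed

lemma matrix_vector_axis: "(A *v axis k u) $ j = A $ j $ k * (u :: 'a::semiring_1)"
proof -
  have "(A *v axis k u) $ j = (\<Sum>i\<in>UNIV. if i = k then A $ j $ i * u else 0)"
    unfolding matrix_vector_mult_def vec_lambda_beta by (rule sum.cong) (auto simp: axis_def)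
  then show ?thesis by simp
qed

definition central :: "'a::cstar_algebra \<Rightarrow> bool"
  where "central a \<longleftrightarrow> (\<forall>x. a * x = x * a)"

text \<open>Let \<open>B x y = ainner (A *v x) y\<close>. Polarising the self-adjointness of \<open>B x x\<close> gives
  \<open>B x y = star (B y x)\<close>. For \<open>x\<close> with the single entry \<open>v\<close> at \<open>k\<close> and \<open>y\<close> with the single entry \<open>1\<close>
  at \<open>j\<close>, the two sides are \<open>A $ j $ k * v\<close> and \<open>star (A $ k $ j * star v) = v * A $ j $ k\<close>.\<close>

lemma positive_mat_entry_central:
  fixes A :: "'a::cstar_algebra ^ 'n ^ 'n"
  assumes "positive_mat A"
  shows "central (A $ j $ k)"
  unfolding central_def
proof
  fix v
  have sa: "star (ainner (A *v x) x) = ainner (A *v x) x" for x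
    using assms by (simp add: positive_mat_def cstar_le_def cstar_positive_def)
  have adj: "star (A $ k $ j) = A $ j $ k"
  proof -
    have "adjoint_mat A $ j $ k = A $ j $ k" using assms by (simp add: positive_mat_def)
    then show ?thesis by (simp add: adjoint_mat_def)
  qed
  have sab: "star (ainner (A *v x) y + ainner (A *v y) x) = ainner (A *v x) y + ainner (A *v y) x"
    (is "star ?r = ?r") for x y
  proof -
    define s where "s = ainner (A *v x) x + ainner (A *v y) y"
    have s: "star s = s" by (simp only: s_def star_add sa)
    have "ainner (A *v (x + y)) (x + y) = s + ?r"
      by (simp only: s_def matrix_vector_right_distrib ainner_add_left ainner_add_right add_ac)
    with sa[of "x + y"] have "star (s + ?r) = s + ?r" by simp
    then show ?thesis by (simp only: star_add[of s] s add_left_cancel)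
  qed
  define p q where "p = A $ j $ k * v" and "q = A $ k $ j * star v"
  have 1: "star (p + q) = p + q"
    using sab[of "axis k v" "axis j 1"]
    by (simp add: ainner_axis_right matrix_vector_axis p_def q_def)
  have "star (\<i> *\<^sub>C p - \<i> *\<^sub>C q) = \<i> *\<^sub>C p - \<i> *\<^sub>C q"
    using sab[of "axis k (\<i> *\<^sub>C v)" "axis j 1"]
    by (simp add: ainner_axis_right matrix_vector_axis p_def q_def star_i mult_scaleC_right scaleC_minus_right)
  \<comment> \<open>another factor \<open>\<i>\<close> turns this into a relation that can be added to the first one\<close>
  then have "\<i> *\<^sub>C (\<i> *\<^sub>C star q - \<i> *\<^sub>C star p) = \<i> *\<^sub>C (\<i> *\<^sub>C p - \<i> *\<^sub>C q)"
    by (simp add: star_diff star_i)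
  then have "star p - star q = q - p" by (simp add: scaleC_diff_right)
  moreover have "2 *\<^sub>R (p - star q) = (p + q - (star p + star q)) + ((star p - star q) - (q - p))"
    by (simp add: scaleR_2 algebra_simps)
  ultimately have "2 *\<^sub>R (p - star q) = 0" using 1 by (simp only: star_add) simp
  then have "p = star q" by simp
  then show "A $ j $ k * v = v * A $ j $ k" by (simp add: p_def q_def star_mult star_star adj)
qed

lemma central_star: "central a \<Longrightarrow> central (star a)"
  unfolding central_def by (metis star_mult star_star)

lemma central_diff: "central a \<Longrightarrow> central b \<Longrightarrow> central (a - b)"
  by (simp add: central_def algebra_simps)

lemma central_scaleR: "central a \<Longrightarrow> central (r *\<^sub>R a)"
  by (simp add: central_def)

lemma central_sum: "(\<And>i. i \<in> I \<Longrightarrow> central (f i)) \<Longrightarrow> central (sum f I)"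
  by (simp add: central_def sum_distrib_left sum_distrib_right)

text \<open>Centrality allows the entries of \<open>B\<close> to be moved next to the entries of \<open>x\<close>, and the form becomes
  the sum over the columns \<open>l\<close> of \<open>star u * u\<close> with \<open>u = (\<Sum>j. B $ j $ l * star (x $ j))\<close>.\<close>

lemma positive_mat_mult_adjoint_central:
  fixes B :: "'a::cstar_algebra ^ 'm ^ 'n"
  assumes B: "\<And>j l. central (B $ j $ l)"
  shows "positive_mat (B ** adjoint_mat B)"
  unfolding positive_mat_def
proof (intro conjI allI)
  show "B ** adjoint_mat B = adjoint_mat (B ** adjoint_mat B)"
    by (simp add: vec_eq_iff adjoint_mat_def matrix_matrix_mult_def star_sum star_mult star_star)
  fix x
  define w where "w j l = B $ j $ l * star (x $ j)" for j l
  have "ainner ((B ** adjoint_mat B) *v x) x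
      = (\<Sum>j\<in>UNIV. \<Sum>k\<in>UNIV. \<Sum>l\<in>UNIV. B $ j $ l * star (B $ k $ l) * x $ k * star (x $ j))"
    by (simp add: ainner_matrix_vector matrix_matrix_mult_def adjoint_mat_def sum_distrib_right)
  also have "\<dots> = (\<Sum>j\<in>UNIV. \<Sum>k\<in>UNIV. \<Sum>l\<in>UNIV. star (w k l) * w j l)"
  proof (intro sum.cong refl)
    fix j k l
    define b e where "b = B $ j $ l" and "e = star (B $ k $ l)"
    have b: "b * u = u * b" and e: "e * u = u * e" for u
      using B central_star[OF B] by (auto simp: central_def b_def e_def)
    have "b * e * x $ k * star (x $ j) = (b * (e * x $ k)) * star (x $ j)"
      by (simp only: mult.assoc)
    also have "\<dots> = ((x $ k * e) * b) * star (x $ j)"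
      by (subst b) (simp only: e)
    finally show "B $ j $ l * star (B $ k $ l) * x $ k * star (x $ j) = star (w k l) * w j l"
      by (simp add: w_def star_mult star_star b_def e_def mult.assoc)
  qed
  also have "\<dots> = (\<Sum>j\<in>UNIV. \<Sum>l\<in>UNIV. \<Sum>k\<in>UNIV. star (w k l) * w j l)"
    by (rule sum.cong[OF refl sum.swap])
  also have "\<dots> = (\<Sum>l\<in>UNIV. \<Sum>j\<in>UNIV. \<Sum>k\<in>UNIV. star (w k l) * w j l)"
    by (rule sum.swap)
  also have "\<dots> = (\<Sum>l\<in>UNIV. star (\<Sum>j\<in>UNIV. w j l) * star (star (\<Sum>j\<in>UNIV. w j l)))"
    by (simp only: star_star star_sum sum_distrib_left sum_distrib_right)
  finally show "0 \<le>\<^sub>A ainner ((B ** adjoint_mat B) *v x) x"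
    by (simp add: cstar_le_def norm_pos_imp_cstar_positive norm_pos_sum norm_pos_mult_star)
qed

section \<open>Row sums of a positive matrix\<close>

theorem theorem3p1:
  fixes A M :: "'a::cstar_algebra ^ 'n ^ 'n" and y :: "'a ^ 'n"
  assumes "positive_mat A"
    and "M = A ** adjoint_mat A"
    and "\<And>j. y $ j = (\<Sum>k\<in>UNIV. A $ j $ k)"
  shows "M \<succeq> (1 / real CARD('n)) *\<^sub>R outer_star y \<and>
    (\<forall>x. (1 / real CARD('n)) *\<^sub>R ainner (outer_star y *v x) x \<le>\<^sub>A ainner (M *v x) x)"
proof -
  define n where "n = real CARD('n)"
  have n: "0 < n" by (simp add: n_def)
  have A: "central (A $ j $ k)" for j k by (rule positive_mat_entry_central[OF assms(1)])
  have y: "central ((1/n) *\<^sub>R y $ j)" for j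
    unfolding assms(3) by (intro central_scaleR central_sum A)
  \<comment> \<open>\<open>A\<close> times the projection onto the constant vectors\<close>
  define Y :: "'a ^ 'n ^ 'n" where "Y = (\<chi> j l. (1/n) *\<^sub>R y $ j)"
  have card: "of_nat CARD('n) * z = n *\<^sub>R z" for z :: 'a
    by (simp add: n_def scaleR_conv_of_real)
  have YY: "Y ** adjoint_mat Y = (1/n) *\<^sub>R outer_star y"
    using n by (simp add: vec_eq_iff matrix_matrix_mult_def adjoint_mat_def Y_def outer_star_def
        card)
  have AY: "(A ** adjoint_mat Y) $ j $ k = (1/n) *\<^sub>R (y $ j * star (y $ k))"
    and YA: "(Y ** adjoint_mat A) $ j $ k = (1/n) *\<^sub>R (y $ j * star (y $ k))" for j k
    by (simp_all add: matrix_matrix_mult_def adjoint_mat_def Y_def assms(3) star_sum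
        flip: sum_distrib_left sum_distrib_right scaleR_sum_right)
  have "(A - Y) ** adjoint_mat (A - Y)
      = A ** adjoint_mat A - A ** adjoint_mat Y - Y ** adjoint_mat A + Y ** adjoint_mat Y"
    by (simp add: vec_eq_iff matrix_matrix_mult_def adjoint_mat_def star_diff algebra_simps
        sum.distrib sum_subtractf)
  also have "\<dots> = M - (1/n) *\<^sub>R outer_star y"
    by (simp add: vec_eq_iff AY YA YY outer_star_def assms(2))
  finally have diff: "(A - Y) ** adjoint_mat (A - Y) = M - (1/n) *\<^sub>R outer_star y" .
  have "positive_mat M"
    unfolding assms(2) by (rule positive_mat_mult_adjoint_central[OF A])
  moreover have "positive_mat ((1/n) *\<^sub>R outer_star y)"
    unfolding YY[symmetric] by (rule positive_mat_mult_adjoint_central) (simp add: Y_def y)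
  moreover have D: "positive_mat (M - (1/n) *\<^sub>R outer_star y)"
    unfolding diff[symmetric]
    by (rule positive_mat_mult_adjoint_central) (simp add: Y_def y A central_diff)
  ultimately have "M \<succeq> (1/n) *\<^sub>R outer_star y" by (simp add: succeq_mat_def)
  moreover have "(1/n) *\<^sub>R ainner (outer_star y *v x) x \<le>\<^sub>A ainner (M *v x) x" for x
  proof -
    have "ainner ((M - (1/n) *\<^sub>R outer_star y) *v x) x
        = ainner (M *v x) x - (1/n) *\<^sub>R ainner (outer_star y *v x) x"
      by (simp add: ainner_matrix_vector left_diff_distrib sum_subtractf scaleR_sum_right)
    then show ?thesis using D by (metis positive_mat_def cstar_le_def diff_zero)
  qed
  ultimately show ?thesis by (simp add: n_def)
qed

end
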